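(* Let $0<\alpha\leq\beta\leq 1$ and let $p>0$ be a fixed real number. Then $PW_p^{\alpha}\subset PS^{\beta}$.
   Context: Throughout $|A|$ denotes the cardinality of a finite set $A$, and all random variables in a sequence, together with its limit, are defined on a common probability space $(S,\triangle,P)$. For $0<\alpha\le 1$, a sequence of random variables $\{X_n\}_{n\in\mathbb{N}}$ is statistically convergent of order $\alpha$ in probability to a random variable $X$ if for all $\varepsilon,\delta>0$, $\lim_{n\to\infty}\frac{1}{n^{\alpha}}|\{k\le n: P(|X_k-X|\ge\varepsilon)\ge\delta\}|=0$. $PS^{\alpha}$ denotes the class of all sequences of random variables which are statistically convergent of order $\alpha$ in probability (to some random variable). For $0<\alpha\le 1$ and a fixed real $p>0$, $\{X_n\}_{n\in\mathbb{N}}$ is strong $p$-Cesàro summable of order $\alpha$ in probability to a random variable $X$ if for every $\varepsilon>0$, $\lim_{n\to\infty}\frac{1}{n^{\alpha}}\sum_{k=1}^{n}\{P(|X_k-X|\ge\varepsilon)\}^p=0$. $PW_p^{\alpha}$ denotes the class of all sequences of random variables which are strong $p$-Cesàro summable of order $\alpha$ in probability (to some random variable). The symbol $\subset$ denotes inclusion, not necessarily proper. *)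

theory Defs
  imports "HOL-Probability.Probability"
begin

text \<open>
  A sequence of random variables is indexed by the positive integers and is represented by a
  function on \<open>nat\<close> whose value at index \<open>0\<close> is ignored; all indices \<open>k\<close> below are at least \<open>1\<close>.
  The definitions are meant for \<open>M\<close> a probability space, \<open>0 < \<alpha> \<le> 1\<close> and \<open>p > 0\<close>.
\<close>

definition stat_conv_prob ::
  "'a measure \<Rightarrow> real \<Rightarrow> (nat \<Rightarrow> 'a \<Rightarrow> real) \<Rightarrow> ('a \<Rightarrow> real) \<Rightarrow> bool" where
  "stat_conv_prob M \<alpha> X Y \<longleftrightarrow>
     (\<forall>\<epsilon>>0. \<forall>\<delta>>0.
        (\<lambda>n. real (card {k \<in> {1..n}. measure M {\<omega> \<in> space M. \<bar>X k \<omega> - Y \<omega>\<bar> \<ge> \<epsilon>} \<ge> \<delta>})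
              / real n powr \<alpha>) \<longlonglongrightarrow> 0)"

definition strong_Cesaro_prob ::
  "'a measure \<Rightarrow> real \<Rightarrow> real \<Rightarrow> (nat \<Rightarrow> 'a \<Rightarrow> real) \<Rightarrow> ('a \<Rightarrow> real) \<Rightarrow> bool" where
  "strong_Cesaro_prob M p \<alpha> X Y \<longleftrightarrow>
     (\<forall>\<epsilon>>0.
        (\<lambda>n. (\<Sum>k=1..n. measure M {\<omega> \<in> space M. \<bar>X k \<omega> - Y \<omega>\<bar> \<ge> \<epsilon>} powr p)
              / real n powr \<alpha>) \<longlonglongrightarrow> 0)"

definition PS :: "'a measure \<Rightarrow> real \<Rightarrow> (nat \<Rightarrow> 'a \<Rightarrow> real) set" where
  "PS M \<alpha> = {X. (\<forall>k\<ge>1. X k \<in> borel_measurable M) \<and>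
                  (\<exists>Y \<in> borel_measurable M. stat_conv_prob M \<alpha> X Y)}"

definition PW :: "'a measure \<Rightarrow> real \<Rightarrow> real \<Rightarrow> (nat \<Rightarrow> 'a \<Rightarrow> real) set" where
  "PW M p \<alpha> = {X. (\<forall>k\<ge>1. X k \<in> borel_measurable M) \<and>
                    (\<exists>Y \<in> borel_measurable M. strong_Cesaro_prob M p \<alpha> X Y)}"

end

theory Submission
  imports Defs
begin

text \<open>This is a Markov-type counting estimate. Write \<open>a k\<close> for the probability
  that \<open>X k\<close> deviates from the limit by at least \<epsilon>. Each index with
  \<open>a k\<close> \<ge> \<delta> contributes at least \<open>\<delta> powr p\<close> to the sum
  of the \<open>a k powr p\<close>, so the number of such indices up to n is at most that sum
  divided by a constant (\<open>card_ge_le_sum_powr\<close>). Dividing by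
  \<open>n powr \<beta>\<close>, which is at least \<open>n powr \<alpha>\<close>, and squeezing
  gives the limit 0 for the same limit variable
  (\<open>strong_Cesaro_prob_imp_stat_conv_prob\<close>).\<close>

lemma card_ge_le_sum_powr:
  fixes a :: "'b \<Rightarrow> real"
  assumes "finite A" and "\<delta> > 0" and "p \<ge> 0"
  shows "real (card {k \<in> A. a k \<ge> \<delta>}) \<le> (\<Sum>k\<in>A. a k powr p) / \<delta> powr p"
proof -
  have "real (card {k \<in> A. a k \<ge> \<delta>}) * \<delta> powr p = (\<Sum>k\<in>{k \<in> A. a k \<ge> \<delta>}. \<delta> powr p)"
    by simp
  also have "\<dots> \<le> (\<Sum>k\<in>{k \<in> A. a k \<ge> \<delta>}. a k powr p)"
    using assms by (intro sum_mono powr_mono2) auto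
  \<comment> \<open>A real \<open>powr\<close> is never negative, so adding the indices with
    \<open>a k\<close> < \<delta> can only increase the sum.\<close>
  also have "\<dots> \<le> (\<Sum>k\<in>A. a k powr p)"
    using assms by (intro sum_mono2) auto
  finally show ?thesis
    using assms by (simp add: pos_le_divide_eq)
qed

lemma strong_Cesaro_prob_imp_stat_conv_prob:
  assumes "\<alpha> \<le> \<beta>" and "p \<ge> 0" and "strong_Cesaro_prob M p \<alpha> X Y"
  shows "stat_conv_prob M \<beta> X Y"
  unfolding stat_conv_prob_def
proof (intro allI impI)
  fix \<epsilon> \<delta> :: real
  assume "\<epsilon> > 0" "\<delta> > 0"
  define a where "a k = measure M {\<omega> \<in> space M. \<bar>X k \<omega> - Y \<omega>\<bar> \<ge> \<epsilon>}" for k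
  define c where "c n = real (card {k \<in> {1..n}. a k \<ge> \<delta>})" for n :: nat
  define s where "s n = (\<Sum>k=1..n. a k powr p)" for n :: nat
  have "(\<lambda>n. s n / real n powr \<alpha>) \<longlonglongrightarrow> 0"
    using assms(3) \<open>\<epsilon> > 0\<close> unfolding strong_Cesaro_prob_def s_def a_def by blast
  then have lim: "(\<lambda>n. s n / real n powr \<alpha> / \<delta> powr p) \<longlonglongrightarrow> 0"
    by (rule tendsto_divide_zero)
  have "c n / real n powr \<beta> \<le> s n / real n powr \<alpha> / \<delta> powr p" if "n \<ge> 1" for n
  proof -
    \<comment> \<open>The order of the exponents enters here: for a base of at least 1, a larger
      exponent gives a larger denominator.\<close>
    have "c n / real n powr \<beta> \<le> c n / real n powr \<alpha>"
      using that assms(1) by (intro divide_left_mono powr_mono) (auto simp: c_def)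
    also have "\<dots> \<le> s n / \<delta> powr p / real n powr \<alpha>"
      unfolding c_def s_def
      using \<open>\<delta> > 0\<close> assms(2) by (intro divide_right_mono card_ge_le_sum_powr) auto
    finally show ?thesis
      by (simp add: mult.commute)
  qed
  then have "\<forall>\<^sub>F n in sequentially. c n / real n powr \<beta> \<le> s n / real n powr \<alpha> / \<delta> powr p"
    by (auto simp: eventually_at_top_linorder)
  \<comment> \<open>Squeeze between the constant 0 and \<open>lim\<close>; the factor
    \<open>\<delta> powr p\<close> is independent of n.\<close>
  then have "(\<lambda>n. c n / real n powr \<beta>) \<longlonglongrightarrow> 0"
    by (intro tendsto_sandwich[OF _ _ tendsto_const lim]) (auto simp: c_def)
  then show "(\<lambda>n. real (card {k \<in> {1..n}. measure M {\<omega> \<in> space M. \<bar>X k \<omega> - Y \<omega>\<bar> \<ge> \<epsilon>} \<ge> \<delta>})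
      / real n powr \<beta>) \<longlonglongrightarrow> 0"
    unfolding c_def a_def .
qed

theorem theorem2p4:
  fixes M :: "'a measure" and \<alpha> \<beta> p :: real
  assumes "prob_space M"
    and "0 < \<alpha>" and "\<alpha> \<le> \<beta>" and "\<beta> \<le> 1"
    and "p > 0"
  shows "PW M p \<alpha> \<subseteq> PS M \<beta>"
  \<comment> \<open>The witness \<open>Y\<close> for membership in \<open>PW\<close> also serves for
    \<open>PS\<close>.\<close>
  using strong_Cesaro_prob_imp_stat_conv_prob[of \<alpha> \<beta> p M] assms(3,5)
  unfolding PW_def PS_def by fastforce

end
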